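(* Let $k\in\mathbb{N}$. A map $\varepsilon\colon X^{\times}_{\mathrm{irr}}\to\mathcal{P}(M)$ is a $k$-restricted Fitch map if and only if (i) $\mathcal{N}[\varepsilon]$ is hierarchy-like, (ii) for every $N=N_m[y]\in\mathcal{N}[\varepsilon]$ and every $y'\in N$ we have $|N_m[y']|\le|N|$, and (iii) for every $N\in\mathcal{N}[\varepsilon]$ with $N\neq X$ we have $|\{m\in M:\text{there is } y\in X \text{ with } N=N_m[y]\}|\le k$.
   Context: $X$ is a finite nonempty set, $M$ a finite nonempty set of colors, $X^{\times}_{\mathrm{irr}}=\{(x,y)\in X\times X: x\neq y\}$. A phylogenetic tree on $X$ is a rooted tree whose leaves (non-root vertices of degree $1$) form $X$, whose root has degree $\ge2$ and whose non-root inner vertices have degree $\ge3$; $\mathrm{lca}(x,y)$ is the last common ancestor. An edge-labeled tree $(T,\lambda)$ on $X$ with $M$ is a phylogenetic tree $T$ on $X$ with $\lambda\colon E(T)\to\mathcal{P}(M)$; $e$ is an $m$-edge if $m\in\lambda(e)$. $(T,\lambda)$ explains $\varepsilon$ if for all $(x,y)\in X^{\times}_{\mathrm{irr}}$, $m\in M$: $m\in\varepsilon(x,y)$ iff the path from $\mathrm{lca}(x,y)$ to $y$ contains an $m$-edge; $\varepsilon$ is a $k$-restricted Fitch map if some edge-labeled tree $(T,\lambda)$ with $|\lambda(e)|\le k$ for all $e\in E(T)$ explains it. $N_m[y]=\{x\in X\setminus\{y\}: m\notin\varepsilon(x,y)\}\cup\{y\}$, $\mathcal{N}[\varepsilon]=\{N_m[y]: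 y\in X, m\in M\}$. A set system is hierarchy-like if any two members $P,Q$ satisfy $P\cap Q\in\{P,Q,\emptyset\}$.
   Formalization: The one-vertex tree is admitted as the phylogenetic tree on a one-element X; with root degree at least 2 required there would be no tree when |X| = 1 and the equivalence would fail there. For |X| ≥ 2 nothing changes. *)

theory Defs
  imports Main "HOL-Library.FuncSet"
begin

record 'v rooted_graph =
  tverts :: "'v set"
  tedges :: "'v set set"
  troot :: 'v

definition path_edges :: "'v list \<Rightarrow> 'v set set" where
  "path_edges p = {{p ! i, p ! Suc i} | i. Suc i < length p}"

definition is_path :: "'v rooted_graph \<Rightarrow> 'v \<Rightarrow> 'v list \<Rightarrow> 'v \<Rightarrow> bool" where
  "is_path T u p v \<longleftrightarrow> p \<noteq> [] \<and> hd p = u \<and> last p = v \<and> distinct p \<and>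
     set p \<subseteq> tverts T \<and> path_edges p \<subseteq> tedges T"

definition is_cycle :: "'v rooted_graph \<Rightarrow> 'v list \<Rightarrow> bool" where
  "is_cycle T p \<longleftrightarrow> 3 \<le> length p \<and> distinct p \<and> set p \<subseteq> tverts T \<and>
     path_edges p \<subseteq> tedges T \<and> {last p, hd p} \<in> tedges T"

text \<open>Finite simple undirected graphs that are connected and acyclic, with a distinguished vertex.\<close>

definition rooted_tree :: "'v rooted_graph \<Rightarrow> bool" where
  "rooted_tree T \<longleftrightarrow>
     finite (tverts T) \<and> troot T \<in> tverts T \<and>
     (\<forall>e\<in>tedges T. e \<subseteq> tverts T \<and> card e = 2) \<and>
     (\<forall>u\<in>tverts T. \<forall>v\<in>tverts T. \<exists>p. is_path T u p v) \<and>
     (\<nexists>p. is_cycle T p)"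

definition degree :: "'v rooted_graph \<Rightarrow> 'v \<Rightarrow> nat" where
  "degree T v = card {e \<in> tedges T. v \<in> e}"

definition leaves :: "'v rooted_graph \<Rightarrow> 'v set" where
  "leaves T = {v \<in> tverts T. v \<noteq> troot T \<and> degree T v = 1}"

text \<open>The first disjunct is the usual convention that the one-vertex tree is the phylogenetic
  tree on a single taxon; the degree conditions alone would admit no tree on a singleton. It is
  never satisfied if \<open>L\<close> has at least two elements.\<close>

definition phylogenetic_tree_on :: "'v set \<Rightarrow> 'v rooted_graph \<Rightarrow> bool" where
  "phylogenetic_tree_on L T \<longleftrightarrow> rooted_tree T \<and>
     (tverts T = {troot T} \<and> L = {troot T} \<or>
      leaves T = L \<and> 2 \<le> degree T (troot T) \<and>
      (\<forall>v \<in> tverts T - {troot T} - leaves T. 3 \<le> degree T v))"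

definition tree_path :: "'v rooted_graph \<Rightarrow> 'v \<Rightarrow> 'v \<Rightarrow> 'v list" where
  "tree_path T u v = (THE p. is_path T u p v)"

definition ancestor :: "'v rooted_graph \<Rightarrow> 'v \<Rightarrow> 'v \<Rightarrow> bool" where
  "ancestor T u v \<longleftrightarrow> u \<in> set (tree_path T (troot T) v)"

definition lca :: "'v rooted_graph \<Rightarrow> 'v \<Rightarrow> 'v \<Rightarrow> 'v" where
  "lca T x y = (THE u. ancestor T u x \<and> ancestor T u y \<and>
     (\<forall>w. ancestor T w x \<and> ancestor T w y \<longrightarrow> ancestor T w u))"

definition irr :: "'a set \<Rightarrow> ('a \<times> 'a) set" where
  "irr X = {(x, y). x \<in> X \<and> y \<in> X \<and> x \<noteq> y}"

text \<open>A leaf \<open>x \<in> X\<close> is represented by the vertex \<open>Inl x\<close>. The summand \<open>nat\<close> supplies unlimited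
  names for inner vertices, so every finite tree with leaf set \<open>X\<close> occurs up to an isomorphism
  that fixes the leaves.\<close>

definition edge_labeled_tree ::
  "'a set \<Rightarrow> 'm set \<Rightarrow> ('a + nat) rooted_graph \<Rightarrow> (('a + nat) set \<Rightarrow> 'm set) \<Rightarrow> bool" where
  "edge_labeled_tree X M T lab \<longleftrightarrow>
     phylogenetic_tree_on (Inl ` X) T \<and> lab \<in> tedges T \<rightarrow> Pow M"

definition explains ::
  "'a set \<Rightarrow> 'm set \<Rightarrow> ('a + nat) rooted_graph \<Rightarrow> (('a + nat) set \<Rightarrow> 'm set) \<Rightarrow>
   ('a \<times> 'a \<Rightarrow> 'm set) \<Rightarrow> bool" where
  "explains X M T lab \<epsilon> \<longleftrightarrow>
     (\<forall>(x, y) \<in> irr X. \<forall>m\<in>M.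
        m \<in> \<epsilon> (x, y) \<longleftrightarrow>
        (\<exists>e \<in> path_edges (tree_path T (lca T (Inl x) (Inl y)) (Inl y)). m \<in> lab e))"

definition restricted_Fitch_map ::
  "nat \<Rightarrow> 'a set \<Rightarrow> 'm set \<Rightarrow> ('a \<times> 'a \<Rightarrow> 'm set) \<Rightarrow> bool" where
  "restricted_Fitch_map k X M \<epsilon> \<longleftrightarrow>
     (\<exists>T lab. edge_labeled_tree X M T lab \<and> (\<forall>e\<in>tedges T. card (lab e) \<le> k) \<and>
        explains X M T lab \<epsilon>)"

definition nbh :: "'a set \<Rightarrow> ('a \<times> 'a \<Rightarrow> 'm set) \<Rightarrow> 'm \<Rightarrow> 'a \<Rightarrow> 'a set" where
  "nbh X \<epsilon> m y = {x \<in> X - {y}. m \<notin> \<epsilon> (x, y)} \<union> {y}"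

definition nbhs :: "'a set \<Rightarrow> 'm set \<Rightarrow> ('a \<times> 'a \<Rightarrow> 'm set) \<Rightarrow> 'a set set" where
  "nbhs X M \<epsilon> = {nbh X \<epsilon> m y | m y. y \<in> X \<and> m \<in> M}"

definition hierarchy_like :: "'a set set \<Rightarrow> bool" where
  "hierarchy_like S \<longleftrightarrow> (\<forall>P\<in>S. \<forall>Q\<in>S. P \<inter> Q \<in> {P, Q, {}})"

end

theory Submission
  imports Defs "HOL-Library.Sublist"
begin

text \<open>
  If \<open>(T, \<lambda>)\<close> explains \<open>\<epsilon>\<close>, then \<open>m \<in> \<epsilon>(x, y)\<close> iff some ancestor of \<open>y\<close> that is not an ancestor of
  \<open>x\<close> has an \<open>m\<close>-edge to its parent. Hence \<open>N\<^sub>m[y]\<close> is the cluster (the set of leaves below) of the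
  lower end of the \<open>m\<close>-edge above \<open>y\<close> that is closest to \<open>y\<close>, or \<open>X\<close> if there is none. Clusters are
  nested or disjoint, and in a phylogenetic tree they determine their vertex, so that every \<open>m\<close> with
  \<open>N = N\<^sub>m[y] \<noteq> X\<close> occurs in the label of one and the same edge.

  Conversely, the neighbourhoods together with \<open>X\<close> and the singletons form the vertices of a tree
  under the covering relation. Label the parent edge of \<open>N\<close> with all \<open>m\<close> such that \<open>N = N\<^sub>m[y]\<close> for
  some \<open>y\<close>. If \<open>N = N\<^sub>m[y']\<close> contains \<open>y\<close>, then (i) and (ii) give \<open>N\<^sub>m[y] \<subseteq> N\<close>, so an \<open>m\<close>-edge above
  \<open>y\<close> that separates \<open>y\<close> from \<open>x\<close> forces \<open>x \<notin> N\<^sub>m[y]\<close>.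
\<close>

section \<open>Paths\<close>

lemma path_edges_Nil [simp]: "path_edges [] = {}"
  by (simp add: path_edges_def)

lemma path_edges_singleton [simp]: "path_edges [a] = {}"
  by (simp add: path_edges_def)

lemma path_edges_Cons_Cons [simp]:
  "path_edges (a # b # p) = insert {a, b} (path_edges (b # p))"
proof (intro equalityI subsetI)
  fix e assume "e \<in> path_edges (a # b # p)"
  then obtain i where i: "e = {(a # b # p) ! i, (a # b # p) ! Suc i}" "Suc i < length (a # b # p)"
    unfolding path_edges_def by blast
  show "e \<in> insert {a, b} (path_edges (b # p))"
  proof (cases i)
    case (Suc j)
    then have "e = {(b # p) ! j, (b # p) ! Suc j}" "Suc j < length (b # p)" using i by auto
    then show ?thesis unfolding path_edges_def by blast
  qed (use i in simp)
next
  fix e assume "e \<in> insert {a, b} (path_edges (b # p))"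
  then consider "e = {a, b}" | i where "e = {(b # p) ! i, (b # p) ! Suc i}" "Suc i < length (b # p)"
    unfolding path_edges_def by blast
  then show "e \<in> path_edges (a # b # p)"
  proof cases
    case 1
    then show ?thesis unfolding path_edges_def by (intro CollectI exI[of _ 0]) simp
  next
    case (2 i)
    then show ?thesis unfolding path_edges_def by (intro CollectI exI[of _ "Suc i"]) simp
  qed
qed

lemma path_edges_append_Cons:
  "path_edges (xs @ y # ys) = path_edges (xs @ [y]) \<union> path_edges (y # ys)"
proof (induction xs)
  case (Cons a xs)
  then show ?case by (cases xs) auto
qed simp

lemma path_edges_rev [simp]: "path_edges (rev p) = path_edges p"
proof (induction p)
  case (Cons a p)
  show ?case
  proof (cases p)
    case (Cons b q)
    have "path_edges (rev q @ [b, a]) = path_edges (rev q @ [b]) \<union> {{b, a}}"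
      using path_edges_append_Cons[of "rev q" b "[a]"] by simp
    then show ?thesis using Cons.IH Cons by (auto simp: insert_commute)
  qed simp
qed simp

lemma path_edges_Cons_iff:
  "e \<in> path_edges (w # ys) \<longleftrightarrow> (\<exists>a z b. ys = a @ z # b \<and> e = {last (w # a), z})"
proof (induction ys arbitrary: w)
  case (Cons y ys)
  show ?case (is "?L \<longleftrightarrow> ?R")
  proof
    assume ?L
    then consider "e = {w, y}" | "e \<in> path_edges (y # ys)" by auto
    then show ?R
    proof cases
      case 1
      then show ?thesis by (intro exI[of _ "[]"]) simp
    next
      case 2
      then obtain a z b where "ys = a @ z # b" "e = {last (y # a), z}" using Cons.IH by blast
      then have "y # ys = (y # a) @ z # b \<and> e = {last (w # y # a), z}" by simp
      then show ?thesis by blast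
    qed
  next
    assume ?R
    then obtain a z b where *: "y # ys = a @ z # b" "e = {last (w # a), z}" by blast
    show ?L
    proof (cases a)
      case (Cons y' a')
      then have "ys = a' @ z # b" "e = {last (y # a'), z}" using * by auto
      then show ?thesis using Cons.IH by auto
    qed (use * in simp)
  qed
qed simp

lemma is_path_singleton: "is_path T u [u] u \<longleftrightarrow> u \<in> tverts T"
  by (simp add: is_path_def)

lemma is_path_append_ConsD:
  assumes "is_path T u (xs @ w # ys) v"
  shows "is_path T u (xs @ [w]) w" "is_path T w (w # ys) v"
proof -
  have "hd (xs @ [w]) = hd (xs @ w # ys)" by (cases xs) auto
  then show "is_path T u (xs @ [w]) w" "is_path T w (w # ys) v"
    using assms path_edges_append_Cons[of xs w ys] by (auto simp: is_path_def)
qed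

lemma is_path_snoc:
  assumes "is_path T u p v" "{v, w} \<in> tedges T" "w \<in> tverts T" "w \<notin> set p"
  shows "is_path T u (p @ [w]) w"
proof -
  obtain q where q: "p = q @ [v]"
    using assms(1) unfolding is_path_def by (metis append_butlast_last_id)
  have "path_edges (q @ v # [w]) = path_edges p \<union> {{v, w}}"
    using path_edges_append_Cons[of q v "[w]"] by (simp add: q)
  then show ?thesis using assms q by (auto simp: is_path_def hd_append)
qed

lemma rtrancl_edges_imp_path:
  assumes "(u, v) \<in> {(a, b). a \<in> tverts T \<and> b \<in> tverts T \<and> {a, b} \<in> tedges T}\<^sup>*" "u \<in> tverts T"
  shows "\<exists>p. is_path T u p v"
  using assms(1)
proof (induction rule: rtrancl_induct)
  case base
  then show ?case using assms(2) is_path_singleton by metis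
next
  case (step y z)
  then obtain p where p: "is_path T u p y" by blast
  show ?case
  proof (cases "z \<in> set p")
    case True
    then obtain xs ys where "p = xs @ z # ys" by (meson split_list)
    then show ?thesis using p is_path_append_ConsD(1) by metis
  next
    case False
    then show ?thesis using is_path_snoc[OF p] step by blast
  qed
qed

text \<open>Two paths that diverge after \<open>u\<close> close up to a cycle at the first vertex where they meet again.\<close>

lemma path_unique:
  assumes "\<nexists>c. is_cycle T c" "is_path T u p v" "is_path T u q v"
  shows "p = q"
  using assms(2,3)
proof (induction "length p" arbitrary: u p q)
  case 0
  then show ?case by (simp add: is_path_def)
next
  case (Suc n)
  obtain p' where p': "p = u # p'" using Suc.prems(1) by (cases p) (auto simp: is_path_def)
  obtain q' where q': "q = u # q'" using Suc.prems(2) by (cases q) (auto simp: is_path_def)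
  have dp: "distinct (u # p')" and dq: "distinct (u # q')"
    using Suc.prems p' q' by (auto simp: is_path_def)
  show ?case
  proof (cases "p' = [] \<or> q' = []")
    case True
    have "u = v" using Suc.prems True p' q' by (auto simp: is_path_def)
    then have "p' = [] \<and> q' = []"
      using Suc.prems p' q' dp dq by (auto simp: is_path_def split: if_splits)
    then show ?thesis using p' q' by simp
  next
    case False
    then obtain a ps b qs where ab: "p' = a # ps" "q' = b # qs" by (meson neq_Nil_conv)
    have pa: "is_path T a p' v" and qb: "is_path T b q' v"
      using Suc.prems p' q' ab is_path_append_ConsD(2)[of T u "[u]" a ps v]
        is_path_append_ConsD(2)[of T u "[u]" b qs v] by auto
    show ?thesis
    proof (cases "a = b")
      case True
      then have "p' = q'" using Suc.hyps(1)[of p' a q'] Suc.hyps(2) pa qb p' by simp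
      then show ?thesis using p' q' by simp
    next
      case False
      have "v \<in> set p'" "v \<in> set q'" using pa qb unfolding is_path_def by (metis last_in_set)+
      then have "\<exists>x\<in>set p'. x \<in> set q'" by blast
      then obtain p1 w p2 where p1: "p' = p1 @ w # p2" "w \<in> set q'" "\<forall>x\<in>set p1. x \<notin> set q'"
        using split_list_first_prop[of p' "\<lambda>x. x \<in> set q'"] by blast
      then obtain q1 q2 where q1: "q' = q1 @ w # q2" by (meson split_list)
      define c where "c = u # p1 @ w # rev q1"
      have "p1 \<noteq> [] \<or> q1 \<noteq> []" using False ab p1 q1 by auto
      then have len: "3 \<le> length c" unfolding c_def by (cases p1; cases q1) auto
      have dist: "distinct c" using dp dq p1 q1 unfolding c_def by auto
      have verts: "set c \<subseteq> tverts T" using Suc.prems p' q' p1 q1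
        unfolding c_def by (auto simp: is_path_def)
      have e1: "path_edges ((u # p1) @ [w]) \<subseteq> tedges T"
        using Suc.prems(1) p' p1 path_edges_append_Cons[of "u # p1" w p2]
        by (simp add: is_path_def)
      have e2: "path_edges ((u # q1) @ [w]) \<subseteq> tedges T"
        using Suc.prems(2) q' q1 path_edges_append_Cons[of "u # q1" w q2]
        by (simp add: is_path_def)
      have q1w: "path_edges ((u # q1) @ [w]) = insert {u, b} (path_edges (q1 @ [w]))"
        using ab q1 by (cases q1) auto
      have "path_edges (w # rev q1) = path_edges (rev (q1 @ [w]))" by simp
      then have "path_edges (w # rev q1) \<subseteq> tedges T"
        using e2 q1w unfolding path_edges_rev by blast
      then have edges: "path_edges c \<subseteq> tedges T"
        using e1 path_edges_append_Cons[of "u # p1" w "rev q1"] unfolding c_def by auto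
      have "last c = b" "hd c = u" using ab q1 unfolding c_def by (cases q1; simp)+
      then have "{last c, hd c} \<in> tedges T" using e2 q1w by (auto simp: insert_commute)
      then have "is_cycle T c" using len dist verts edges unfolding is_cycle_def by blast
      then show ?thesis using assms(1) by blast
    qed
  qed
qed

section \<open>Ancestors and last common ancestors\<close>

locale tree =
  fixes T :: "'v rooted_graph"
  assumes rooted_tree: "rooted_tree T"
begin

abbreviation root_path :: "'v \<Rightarrow> 'v list" where
  "root_path v \<equiv> tree_path T (troot T) v"

definition parent :: "'v \<Rightarrow> 'v" where
  "parent v = last (butlast (root_path v))"

lemma finite_verts: "finite (tverts T)"
  and root_in_verts: "troot T \<in> tverts T"
  using rooted_tree by (auto simp: rooted_tree_def)

lemma edgeD: "{u, v} \<in> tedges T \<Longrightarrow> u \<in> tverts T \<and> v \<in> tverts T \<and> u \<noteq> v"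
  using rooted_tree by (auto simp: rooted_tree_def)

lemma edgeE:
  assumes "e \<in> tedges T" "v \<in> e"
  obtains w where "e = {v, w}" "w \<noteq> v"
proof -
  have "card e = 2" using assms rooted_tree by (auto simp: rooted_tree_def)
  then show ?thesis using assms that by (auto simp: card_2_iff)
qed

lemma tree_path_eqI: "is_path T u p v \<Longrightarrow> tree_path T u v = p"
  unfolding tree_path_def
  using path_unique rooted_tree unfolding rooted_tree_def by (metis the_equality)

lemma is_path_tree_path: "u \<in> tverts T \<Longrightarrow> v \<in> tverts T \<Longrightarrow> is_path T u (tree_path T u v) v"
  using rooted_tree tree_path_eqI unfolding rooted_tree_def by metis

lemma is_path_root_path: "v \<in> tverts T \<Longrightarrow> is_path T (troot T) (root_path v) v"
  using is_path_tree_path root_in_verts by blast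

lemma root_path_split:
  assumes "v \<in> tverts T" "root_path v = xs @ w # ys"
  shows "w \<in> tverts T" "root_path w = xs @ [w]" "tree_path T w v = w # ys"
proof -
  have "is_path T (troot T) (xs @ w # ys) v" using is_path_root_path assms by metis
  from is_path_append_ConsD[OF this] this
  show "w \<in> tverts T" "root_path w = xs @ [w]" "tree_path T w v = w # ys"
    by (auto intro: tree_path_eqI simp: is_path_def)
qed

lemma root_path_root: "root_path (troot T) = [troot T]"
  by (rule tree_path_eqI) (simp add: is_path_singleton root_in_verts)

lemma root_path_ends:
  assumes "v \<in> tverts T"
  shows "root_path v \<noteq> []" "hd (root_path v) = troot T" "last (root_path v) = v"
  using is_path_root_path[OF assms] by (auto simp: is_path_def)

lemma ancestor_in_verts: "v \<in> tverts T \<Longrightarrow> ancestor T u v \<Longrightarrow> u \<in> tverts T"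
  using is_path_root_path by (auto simp: ancestor_def is_path_def)

lemma ancestor_refl: "v \<in> tverts T \<Longrightarrow> ancestor T v v"
  unfolding ancestor_def using root_path_ends by (metis last_in_set)

lemma ancestor_root: "v \<in> tverts T \<Longrightarrow> ancestor T (troot T) v"
  unfolding ancestor_def using root_path_ends by (metis hd_in_set)

lemma ancestor_iff_prefix:
  assumes "v \<in> tverts T" "u \<in> tverts T"
  shows "ancestor T u v \<longleftrightarrow> prefix (root_path u) (root_path v)"
proof
  assume "ancestor T u v"
  then obtain xs ys where *: "root_path v = xs @ u # ys"
    unfolding ancestor_def by (meson split_list)
  then show "prefix (root_path u) (root_path v)"
    using root_path_split(2)[OF assms(1) *] by simp
next
  assume "prefix (root_path u) (root_path v)"
  then show "ancestor T u v"
    using ancestor_refl[OF assms(2)] set_mono_prefix unfolding ancestor_def by fastforce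
qed

lemma ancestor_trans:
  assumes "w \<in> tverts T" "ancestor T u v" "ancestor T v w"
  shows "ancestor T u w"
proof -
  have v: "v \<in> tverts T" using assms ancestor_in_verts by blast
  then have u: "u \<in> tverts T" using assms ancestor_in_verts by blast
  have "prefix (root_path u) (root_path v)" "prefix (root_path v) (root_path w)"
    using assms ancestor_iff_prefix u v by auto
  then show ?thesis unfolding ancestor_iff_prefix[OF assms(1) u] by (rule prefix_order.trans)
qed

lemma ancestor_antisym:
  assumes "v \<in> tverts T" "ancestor T u v" "ancestor T v u"
  shows "u = v"
proof -
  have u: "u \<in> tverts T" using assms ancestor_in_verts by blast
  have "prefix (root_path u) (root_path v)" "prefix (root_path v) (root_path u)"
    using assms ancestor_iff_prefix u by auto
  then have "root_path u = root_path v" by (rule prefix_order.antisym)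
  then show ?thesis using root_path_ends(3)[OF u] root_path_ends(3)[OF assms(1)] by metis
qed

lemma ancestor_linear:
  assumes "x \<in> tverts T" "ancestor T u x" "ancestor T v x"
  shows "ancestor T u v \<or> ancestor T v u"
proof -
  have uv: "u \<in> tverts T" "v \<in> tverts T" using assms ancestor_in_verts by auto
  have "prefix (root_path u) (root_path x)" "prefix (root_path v) (root_path x)"
    using assms ancestor_iff_prefix uv by auto
  then show ?thesis using ancestor_iff_prefix uv prefix_same_cases by blast
qed

lemma root_path_parent:
  assumes "v \<in> tverts T" "v \<noteq> troot T"
  shows "root_path v = root_path (parent v) @ [v]" "{parent v, v} \<in> tedges T"
proof -
  obtain q where q: "root_path v = q @ [v]" using root_path_ends[OF assms(1)]
    by (metis append_butlast_last_id)
  have "q \<noteq> []" using q root_path_ends(2)[OF assms(1)] assms(2) by auto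
  then obtain q' where q': "q = q' @ [parent v]"
    unfolding parent_def q by (metis append_butlast_last_id butlast_snoc)
  have rp: "root_path v = q' @ parent v # [v]" using q q' by simp
  show "root_path v = root_path (parent v) @ [v]"
    using root_path_split(2)[OF assms(1) rp] rp by simp
  have "path_edges (q' @ parent v # [v]) \<subseteq> tedges T"
    using is_path_root_path[OF assms(1)] rp by (simp add: is_path_def)
  then show "{parent v, v} \<in> tedges T"
    using path_edges_append_Cons[of q' "parent v" "[v]"] by simp
qed

lemma edge_cases:
  assumes "{u, v} \<in> tedges T"
  shows "v \<noteq> troot T \<and> u = parent v \<or> u \<noteq> troot T \<and> v = parent u"
proof -
  have uv: "u \<in> tverts T" "v \<in> tverts T" "u \<noteq> v" using edgeD[OF assms] by auto
  show ?thesis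
  proof (cases "v \<in> set (root_path u)")
    case False
    then have "root_path v = root_path u @ [v]"
      using is_path_snoc[OF is_path_root_path[OF uv(1)] assms uv(2)] tree_path_eqI by blast
    then have "v \<noteq> troot T" "u = parent v"
      using root_path_ends[OF uv(1)] by (auto simp: parent_def root_path_root)
    then show ?thesis by blast
  next
    case True
    then obtain xs ys where *: "root_path u = xs @ v # ys" by (meson split_list)
    have "is_path T v [v, u] u" using uv assms by (auto simp: is_path_def insert_commute)
    then have "v # ys = [v, u]" using root_path_split(3)[OF uv(1) *] tree_path_eqI by metis
    then have "root_path u = xs @ [v, u]" using * by simp
    then have "u \<noteq> troot T" "v = parent u"
      by (auto simp: parent_def butlast_append root_path_root)
    then show ?thesis by blast
  qed
qed

lemma ancestor_parent:
  assumes "v \<in> tverts T" "v \<noteq> troot T"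
  shows "ancestor T u v \<longleftrightarrow> u = v \<or> ancestor T u (parent v)"
  unfolding ancestor_def root_path_parent(1)[OF assms] by auto

lemma parent_in_verts: "v \<in> tverts T \<Longrightarrow> v \<noteq> troot T \<Longrightarrow> parent v \<in> tverts T"
  using root_path_parent(2) edgeD by blast

lemma not_ancestor_parent:
  assumes "v \<in> tverts T" "v \<noteq> troot T"
  shows "\<not> ancestor T v (parent v)"
proof -
  have "distinct (root_path v)" using is_path_root_path[OF assms(1)] by (simp add: is_path_def)
  then show ?thesis using root_path_parent(1)[OF assms] by (simp add: ancestor_def)
qed

lemma path_edges_lca:
  assumes "x \<in> tverts T" "y \<in> tverts T"
  shows "path_edges (tree_path T (lca T x y) y) =
    {{parent z, z} | z. ancestor T z y \<and> \<not> ancestor T z x}"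
proof -
  obtain ps xs' ys' where ps: "root_path x = ps @ xs'" "root_path y = ps @ ys'"
    "xs' = [] \<or> ys' = [] \<or> hd xs' \<noteq> hd ys'"
    using longest_common_prefix by metis
  have "ps \<noteq> []"
  proof
    assume "ps = []"
    then show False using ps root_path_ends[OF assms(1)] root_path_ends[OF assms(2)] by auto
  qed
  then obtain c w where "ps = c @ [w]" by (metis append_butlast_last_id)
  then have px: "root_path x = c @ w # xs'" and py: "root_path y = c @ w # ys'" using ps by auto
  have disj: "z \<notin> set (root_path x)" if z: "z \<in> set ys'" for z
  proof
    assume "z \<in> set (root_path x)"
    then obtain a b where x: "root_path x = a @ z # b" by (meson split_list)
    obtain y1 y2 where y: "ys' = y1 @ z # y2" using z by (meson split_list)
    have "a @ [z] = (c @ w # y1) @ [z]"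
      using root_path_split(2)[OF assms(1) x] root_path_split(2)[OF assms(2), of "c @ w # y1" z y2]
        py y by simp
    then have "xs' = y1 @ z # b" using px x by auto
    then show False using ps(3) y by (cases y1) auto
  qed
  have pw: "root_path w = c @ [w]" using root_path_split(2)[OF assms(1) px] .
  have w: "ancestor T w x \<and> ancestor T w y" by (simp add: ancestor_def px py)
  have common: "ancestor T u w" if "ancestor T u x" "ancestor T u y" for u
    using that disj[of u] py pw by (auto simp: ancestor_def)
  have "lca T x y = w"
    unfolding lca_def
  proof (rule the_equality)
    fix u assume "ancestor T u x \<and> ancestor T u y \<and>
      (\<forall>w. ancestor T w x \<and> ancestor T w y \<longrightarrow> ancestor T w u)"
    then show "u = w" using common w ancestor_antisym ancestor_in_verts assms by blast
  qed (use w common in blast)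
  then have path: "tree_path T (lca T x y) y = w # ys'"
    using root_path_split(3)[OF assms(2) py] by simp
  have parent: "parent z = last (w # a)" if "ys' = a @ z # b" for a z b
    using root_path_split(2)[OF assms(2), of "c @ w # a" z b] that py
    by (simp add: parent_def butlast_append)
  have anc: "ancestor T z y \<and> \<not> ancestor T z x \<longleftrightarrow> z \<in> set ys'" for z
    using disj px py by (auto simp: ancestor_def)
  show ?thesis
    unfolding path anc
  proof (intro equalityI subsetI)
    fix e assume "e \<in> path_edges (w # ys')"
    then obtain a z b where "ys' = a @ z # b" "e = {last (w # a), z}"
      unfolding path_edges_Cons_iff by blast
    then have "e = {parent z, z}" "z \<in> set ys'" using parent by auto
    then show "e \<in> {{parent z, z} | z. z \<in> set ys'}" by blast
  next
    fix e assume "e \<in> {{parent z, z} | z. z \<in> set ys'}"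
    then obtain z where z: "e = {parent z, z}" "z \<in> set ys'" by blast
    then obtain a b where "ys' = a @ z # b" by (meson split_list)
    then show "e \<in> path_edges (w # ys')"
      unfolding path_edges_Cons_iff using parent z by metis
  qed
qed

lemma ancestor_eqI_depth:
  assumes "z \<in> tverts T" "ancestor T v z" "length (root_path z) \<le> length (root_path v)"
  shows "v = z"
proof -
  have v: "v \<in> tverts T" using assms ancestor_in_verts by blast
  have "prefix (root_path v) (root_path z)" using assms ancestor_iff_prefix v by blast
  then have "root_path v = root_path z" using assms(3) by (auto simp: prefix_def)
  then show ?thesis using root_path_ends(3) v assms by metis
qed

lemma ex_deepest:
  assumes "D \<subseteq> tverts T" "D \<noteq> {}"
  obtains v where "v \<in> D" "\<And>u. u \<in> D \<Longrightarrow> length (root_path u) \<le> length (root_path v)"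
proof -
  have fin: "finite ((\<lambda>u. length (root_path u)) ` D)"
    using assms finite_verts finite_subset by blast
  then have "Max ((\<lambda>u. length (root_path u)) ` D) \<in> (\<lambda>u. length (root_path u)) ` D"
    using assms by (intro Max_in) auto
  then obtain v where v: "v \<in> D" "length (root_path v) = Max ((\<lambda>u. length (root_path u)) ` D)"
    by auto
  show ?thesis by (rule that[OF v(1)]) (use v(2) fin in simp)
qed

lemma ex_child_towards:
  assumes "v \<in> tverts T" "ancestor T u v" "u \<noteq> v"
  obtains c where "c \<in> tverts T" "c \<noteq> troot T" "parent c = u" "ancestor T c v"
proof -
  obtain xs ys where *: "root_path v = xs @ u # ys"
    using assms(2) unfolding ancestor_def by (meson split_list)
  have "ys \<noteq> []" using * root_path_ends(3)[OF assms(1)] assms(3) by auto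
  then obtain c zs where "ys = c # zs" by (meson neq_Nil_conv)
  then have rv: "root_path v = (xs @ [u]) @ c # zs" using * by simp
  have c: "c \<in> tverts T" "root_path c = (xs @ [u]) @ [c]"
    using root_path_split[OF assms(1) rv] by auto
  have "c \<noteq> troot T" using c root_path_root by auto
  moreover have "parent c = u" by (simp add: parent_def c(2) butlast_append)
  moreover have "ancestor T c v" by (simp add: ancestor_def rv)
  ultimately show ?thesis using that c by blast
qed

lemma siblings_no_common_descendant:
  assumes "x \<in> tverts T" "ancestor T c x" "ancestor T d x" "c \<noteq> troot T" "d \<noteq> troot T"
    and "parent c = parent d"
  shows "c = d"
proof (rule ccontr)
  assume "c \<noteq> d"
  have cd: "c \<in> tverts T" "d \<in> tverts T" using assms ancestor_in_verts by auto
  then show False using ancestor_linear[OF assms(1-3)] \<open>c \<noteq> d\<close> assms(4-6)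
      ancestor_parent[of c d] ancestor_parent[of d c] not_ancestor_parent[of c]
      not_ancestor_parent[of d] by auto
qed

section \<open>Clusters of a phylogenetic tree\<close>

lemma phylogenetic_tree_on_subset: "phylogenetic_tree_on L T \<Longrightarrow> L \<subseteq> tverts T"
  by (auto simp: phylogenetic_tree_on_def leaves_def)

lemma ex_leaf_below:
  assumes phy: "phylogenetic_tree_on L T" and v: "v \<in> tverts T"
  shows "\<exists>x\<in>L. ancestor T v x"
proof -
  obtain u where u: "u \<in> {u \<in> tverts T. ancestor T v u}"
    and deep: "\<And>w. w \<in> {u \<in> tverts T. ancestor T v u} \<Longrightarrow>
      length (root_path w) \<le> length (root_path u)"
    using ex_deepest[of "{u \<in> tverts T. ancestor T v u}"] v ancestor_refl by blast
  then have uV: "u \<in> tverts T" and vu: "ancestor T v u" by auto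
  have edges: "e = {parent u, u} \<and> u \<noteq> troot T" if e: "e \<in> tedges T" "u \<in> e" for e
  proof -
    obtain w where w: "e = {u, w}" using edgeE[OF e] by blast
    then have wV: "w \<in> tverts T" using e edgeD by blast
    have "\<not> (w \<noteq> troot T \<and> u = parent w)"
    proof
      assume "w \<noteq> troot T \<and> u = parent w"
      then have "ancestor T v w" "length (root_path w) > length (root_path u)"
        using root_path_parent(1)[OF wV] ancestor_parent[OF wV] vu by auto
      then show False using deep[of w] wV by auto
    qed
    then show ?thesis using edge_cases[of u w] e w by (auto simp: insert_commute)
  qed
  have "u \<in> L"
  proof (cases "tverts T = {troot T} \<and> L = {troot T}")
    case True
    then show ?thesis using uV by auto
  next
    case False
    then have gen: "leaves T = L" "2 \<le> degree T (troot T)"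
      "\<forall>v \<in> tverts T - {troot T} - leaves T. 3 \<le> degree T v"
      using phy by (auto simp: phylogenetic_tree_on_def)
    have sub: "{e \<in> tedges T. u \<in> e} \<subseteq> {{parent u, u}}" using edges by blast
    then have "degree T u \<le> 1"
      unfolding degree_def using card_mono[OF _ sub] by simp
    then show ?thesis using gen uV by force
  qed
  then show ?thesis using vu by blast
qed

lemma ex_leaf_separating:
  assumes phy: "phylogenetic_tree_on L T" and v: "v \<in> tverts T"
    and uv: "ancestor T u v" "u \<noteq> v"
  shows "\<exists>x\<in>L. ancestor T u x \<and> \<not> ancestor T v x"
proof -
  have u: "u \<in> tverts T" using uv v ancestor_in_verts by blast
  have nontrivial: "tverts T \<noteq> {troot T}" using u v uv(2) by (metis singletonD)
  have gen: "leaves T = L" "2 \<le> degree T (troot T)"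
    "\<forall>v \<in> tverts T - {troot T} - leaves T. 3 \<le> degree T v"
    using phy nontrivial unfolding phylogenetic_tree_on_def by blast+
  obtain c where c: "c \<in> tverts T" "c \<noteq> troot T" "parent c = u" "ancestor T c v"
    using ex_child_towards[OF v uv] by blast
  have cu: "{u, c} \<in> tedges T" using root_path_parent(2)[OF c(1,2)] c(3) by simp
  define B where "B = (if u = troot T then {{u, c}} else {{parent u, u}, {u, c}})"
  have "finite B" by (simp add: B_def)
  have "card B < degree T u"
  proof (cases "u = troot T")
    case True
    then show ?thesis using gen(2) by (simp add: B_def)
  next
    case False
    have "\<not> ancestor T c u" using not_ancestor_parent[OF c(1,2)] c(3) by simp
    moreover have "ancestor T (parent u) u"
      using ancestor_parent[OF u False] ancestor_refl parent_in_verts[OF u False] by blast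
    ultimately have ne: "{parent u, u} \<noteq> {u, c}" by (auto simp: doubleton_eq_iff)
    have "degree T u \<noteq> 1"
    proof
      assume "degree T u = 1"
      then obtain e where "{e \<in> tedges T. u \<in> e} = {e}"
        unfolding degree_def by (auto simp: card_1_singleton_iff)
      moreover have "{parent u, u} \<in> {e \<in> tedges T. u \<in> e}" "{u, c} \<in> {e \<in> tedges T. u \<in> e}"
        using root_path_parent(2)[OF u False] cu by auto
      ultimately show False using ne by auto
    qed
    then have "3 \<le> degree T u" using gen(3) u False by (auto simp: leaves_def)
    then show ?thesis using ne False by (simp add: B_def)
  qed
  then have "\<not> {e \<in> tedges T. u \<in> e} \<subseteq> B"
    using card_mono[OF \<open>finite B\<close>, of "{e \<in> tedges T. u \<in> e}"] unfolding degree_def by linarith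
  then obtain e where e: "e \<in> tedges T" "u \<in> e" "e \<notin> B" by blast
  obtain w where w: "e = {u, w}" using edgeE[OF e(1,2)] by blast
  have wc: "w \<noteq> troot T" "parent w = u" "w \<noteq> c"
    using edge_cases[of u w] e w by (auto simp: B_def insert_commute split: if_splits)
  have wV: "w \<in> tverts T" using edgeD e(1) w by blast
  obtain x where x: "x \<in> L" "ancestor T w x" using ex_leaf_below[OF phy wV] by blast
  have xV: "x \<in> tverts T" using x(1) phylogenetic_tree_on_subset[OF phy] by blast
  have "ancestor T u w"
    using ancestor_parent[OF wV wc(1)] ancestor_refl[OF u] wc(2) by simp
  then have "ancestor T u x" using ancestor_trans[OF xV] x(2) by blast
  moreover have "\<not> ancestor T v x"
    using siblings_no_common_descendant[OF xV x(2), of c] ancestor_trans[OF xV c(4)] c wc by auto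
  ultimately show ?thesis using x(1) by blast
qed

lemma cluster_inj:
  assumes phy: "phylogenetic_tree_on L T" and "u \<in> tverts T" "v \<in> tverts T"
    and eq: "{x \<in> L. ancestor T u x} = {x \<in> L. ancestor T v x}"
  shows "u = v"
proof (rule ccontr)
  assume "u \<noteq> v"
  obtain x where x: "x \<in> L" "ancestor T u x" using ex_leaf_below[OF phy] assms by blast
  then have "ancestor T v x" "x \<in> tverts T"
    using eq phylogenetic_tree_on_subset[OF phy] by auto
  then have "ancestor T u v \<or> ancestor T v u" using x ancestor_linear by blast
  then show False
    using ex_leaf_separating[OF phy, of v u] ex_leaf_separating[OF phy, of u v] assms \<open>u \<noteq> v\<close>
    by blast
qed

end

text \<open>The vertex \<open>v\<close> is the lower end of the first \<open>m\<close>-edge met on the way from \<open>y\<close> to the root, or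
  the root if there is none.\<close>

lemma nbh_eq_cluster:
  assumes elt: "edge_labeled_tree X M T lab" and expl: "explains X M T lab \<epsilon>"
    and y: "y \<in> X" and m: "m \<in> M"
  obtains v where "ancestor T v (Inl y)" "v = troot T \<or> m \<in> lab {tree.parent T v, v}"
    "nbh X \<epsilon> m y = {x \<in> X. ancestor T v (Inl x)}"
proof -
  have phy: "phylogenetic_tree_on (Inl ` X) T" using elt by (simp add: edge_labeled_tree_def)
  then interpret tree T by unfold_locales (simp add: phylogenetic_tree_on_def)
  have XV: "Inl x \<in> tverts T" if "x \<in> X" for x
    using phylogenetic_tree_on_subset[OF phy] that by blast
  define Z where "Z = {z. ancestor T z (Inl y) \<and> (z = troot T \<or> m \<in> lab {parent z, z})}"
  have "Z \<subseteq> tverts T" using ancestor_in_verts XV[OF y] by (auto simp: Z_def)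
  moreover have "troot T \<in> Z" using ancestor_root XV[OF y] by (auto simp: Z_def)
  ultimately obtain v where v: "v \<in> Z"
    and deep: "\<And>u. u \<in> Z \<Longrightarrow> length (root_path u) \<le> length (root_path v)"
    using ex_deepest[of Z] by blast
  have above: "ancestor T z v" if z: "z \<in> Z" for z
  proof -
    have "ancestor T z v \<or> ancestor T v z"
      using z v XV[OF y] ancestor_linear unfolding Z_def by blast
    moreover have "z \<in> tverts T" using z \<open>Z \<subseteq> tverts T\<close> by blast
    ultimately show ?thesis using ancestor_eqI_depth[of z v] deep[OF z] ancestor_refl by blast
  qed
  have sep: "m \<in> \<epsilon> (x, y) \<longleftrightarrow> \<not> ancestor T v (Inl x)" if x: "x \<in> X" "x \<noteq> y" for x
  proof -
    have "m \<in> \<epsilon> (x, y) \<longleftrightarrow>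
        (\<exists>e \<in> path_edges (tree_path T (lca T (Inl x) (Inl y)) (Inl y)). m \<in> lab e)"
      using expl x y m by (auto simp: explains_def irr_def)
    also have "\<dots> \<longleftrightarrow>
        (\<exists>z. ancestor T z (Inl y) \<and> \<not> ancestor T z (Inl x) \<and> m \<in> lab {parent z, z})"
      unfolding path_edges_lca[OF XV[OF x(1)] XV[OF y]] by blast
    also have "\<dots> \<longleftrightarrow> (\<exists>z\<in>Z. \<not> ancestor T z (Inl x))"
      using ancestor_root[OF XV[OF x(1)]] by (auto simp: Z_def)
    also have "\<dots> \<longleftrightarrow> \<not> ancestor T v (Inl x)"
      using v above ancestor_trans[OF XV[OF x(1)]] by blast
    finally show ?thesis .
  qed
  have "ancestor T v (Inl y)" using v by (simp add: Z_def)
  then have "nbh X \<epsilon> m y = {x \<in> X. ancestor T v (Inl x)}"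
    unfolding nbh_def using sep y by blast
  then show ?thesis using that v by (auto simp: Z_def)
qed

lemma restricted_Fitch_map_imp:
  assumes fin: "finite M" and fitch: "restricted_Fitch_map k X M \<epsilon>"
  shows "hierarchy_like (nbhs X M \<epsilon>)"
    and "\<forall>m\<in>M. \<forall>y\<in>X. \<forall>y'\<in>nbh X \<epsilon> m y. nbh X \<epsilon> m y' \<subseteq> nbh X \<epsilon> m y"
    and "\<forall>N\<in>nbhs X M \<epsilon>. N \<noteq> X \<longrightarrow> card {m \<in> M. \<exists>y\<in>X. N = nbh X \<epsilon> m y} \<le> k"
proof -
  obtain T lab where elt: "edge_labeled_tree X M T lab"
    and k: "\<forall>e\<in>tedges T. card (lab e) \<le> k" and expl: "explains X M T lab \<epsilon>"
    using fitch by (auto simp: restricted_Fitch_map_def)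
  have phy: "phylogenetic_tree_on (Inl ` X) T" and lab: "lab \<in> tedges T \<rightarrow> Pow M"
    using elt by (simp_all add: edge_labeled_tree_def)
  then interpret tree T by unfold_locales (simp add: phylogenetic_tree_on_def)
  have XV: "Inl x \<in> tverts T" if "x \<in> X" for x
    using phylogenetic_tree_on_subset[OF phy] that by blast
  note cluster = nbh_eq_cluster[OF elt expl]
  show "hierarchy_like (nbhs X M \<epsilon>)"
    unfolding hierarchy_like_def
  proof (intro ballI)
    fix P Q assume "P \<in> nbhs X M \<epsilon>" "Q \<in> nbhs X M \<epsilon>"
    then obtain u v where P: "P = {x \<in> X. ancestor T u (Inl x)}"
      and Q: "Q = {x \<in> X. ancestor T v (Inl x)}"
      unfolding nbhs_def using cluster by (smt (verit, best) mem_Collect_eq)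
    show "P \<inter> Q \<in> {P, Q, {}}"
    proof (cases "P \<inter> Q = {}")
      case False
      then obtain x where "x \<in> X" "ancestor T u (Inl x)" "ancestor T v (Inl x)" using P Q by blast
      then have "ancestor T u v \<or> ancestor T v u" using ancestor_linear XV by blast
      then have "Q \<subseteq> P \<or> P \<subseteq> Q" using ancestor_trans XV unfolding P Q by blast
      then show ?thesis by blast
    qed simp
  qed
  show "\<forall>m\<in>M. \<forall>y\<in>X. \<forall>y'\<in>nbh X \<epsilon> m y. nbh X \<epsilon> m y' \<subseteq> nbh X \<epsilon> m y"
  proof (intro ballI)
    fix m y y' assume m: "m \<in> M" and y: "y \<in> X" and y': "y' \<in> nbh X \<epsilon> m y"
    obtain v where v: "v = troot T \<or> m \<in> lab {parent v, v}"
      "nbh X \<epsilon> m y = {x \<in> X. ancestor T v (Inl x)}" using cluster[OF y m] by blast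
    have y'X: "y' \<in> X" and vy': "ancestor T v (Inl y')" using v(2) y' by auto
    show "nbh X \<epsilon> m y' \<subseteq> nbh X \<epsilon> m y"
    proof
      fix x assume x: "x \<in> nbh X \<epsilon> m y'"
      then have xX: "x \<in> X" using y'X by (auto simp: nbh_def)
      have "ancestor T v (Inl x)"
      proof (rule ccontr)
        assume nv: "\<not> ancestor T v (Inl x)"
        then have "x \<noteq> y'" "m \<in> lab {parent v, v}"
          using vy' v(1) ancestor_root[OF XV[OF xX]] by auto
        moreover have "{parent v, v} \<in> path_edges (tree_path T (lca T (Inl x) (Inl y')) (Inl y'))"
          unfolding path_edges_lca[OF XV[OF xX] XV[OF y'X]] using nv vy' by blast
        ultimately have "m \<in> \<epsilon> (x, y')" using expl xX y'X m by (fastforce simp: explains_def irr_def)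
        then show False using x \<open>x \<noteq> y'\<close> by (simp add: nbh_def)
      qed
      then show "x \<in> nbh X \<epsilon> m y" using v(2) xX by simp
    qed
  qed
  show "\<forall>N\<in>nbhs X M \<epsilon>. N \<noteq> X \<longrightarrow> card {m \<in> M. \<exists>y\<in>X. N = nbh X \<epsilon> m y} \<le> k"
  proof (intro ballI impI)
    fix N assume N: "N \<in> nbhs X M \<epsilon>" "N \<noteq> X"
    obtain m0 y0 where my0: "m0 \<in> M" "y0 \<in> X" "N = nbh X \<epsilon> m0 y0" using N by (auto simp: nbhs_def)
    obtain v where v: "ancestor T v (Inl y0)" "N = {x \<in> X. ancestor T v (Inl x)}"
      using cluster[OF my0(2,1)] my0(3) by metis
    have vV: "v \<in> tverts T" using v(1) my0(2) XV ancestor_in_verts by blast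
    have "v \<noteq> troot T" using N(2) v(2) ancestor_root XV by blast
    then have e: "{parent v, v} \<in> tedges T" using root_path_parent(2) vV by blast
    have "m \<in> lab {parent v, v}" if my: "m \<in> M" "y \<in> X" "N = nbh X \<epsilon> m y" for m y
    proof -
      obtain w where w: "ancestor T w (Inl y)" "w = troot T \<or> m \<in> lab {parent w, w}"
        "N = {x \<in> X. ancestor T w (Inl x)}" using cluster[OF my(2,1)] my(3) by metis
      have "w \<in> tverts T" using w(1) my(2) XV ancestor_in_verts by blast
      moreover have "{x \<in> Inl ` X. ancestor T w x} = {x \<in> Inl ` X. ancestor T v x}"
        using v(2) w(3) by blast
      ultimately have "w = v" using cluster_inj[OF phy _ vV] by blast
      then show ?thesis using w(2) \<open>v \<noteq> troot T\<close> by blast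
    qed
    then have "{m \<in> M. \<exists>y\<in>X. N = nbh X \<epsilon> m y} \<subseteq> lab {parent v, v}" by blast
    moreover have "finite (lab {parent v, v})"
      using lab e fin finite_subset by blast
    ultimately show "card {m \<in> M. \<exists>y\<in>X. N = nbh X \<epsilon> m y} \<le> k"
      using k e card_mono order_trans by meson
  qed
qed

section \<open>The tree of a hierarchy\<close>

locale hierarchy =
  fixes V :: "'v set" and S :: "'v \<Rightarrow> 'a set" and r :: 'v and X :: "'a set" and leaf :: "'a \<Rightarrow> 'v"
  assumes finite_V: "finite V" and inj_S: "inj_on S V"
    and nested: "\<And>u v. u \<in> V \<Longrightarrow> v \<in> V \<Longrightarrow> S u \<inter> S v \<in> {S u, S v, {}}"
    and nonempty: "\<And>v. v \<in> V \<Longrightarrow> S v \<noteq> {}" and subset_X: "\<And>v. v \<in> V \<Longrightarrow> S v \<subseteq> X"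
    and root: "r \<in> V" "S r = X" and finite_X: "finite X" and card_X: "2 \<le> card X"
    and leaf: "\<And>x. x \<in> X \<Longrightarrow> leaf x \<in> V" "\<And>x. x \<in> X \<Longrightarrow> S (leaf x) = {x}"
begin

lemma S_eq_iff: "u \<in> V \<Longrightarrow> v \<in> V \<Longrightarrow> S u = S v \<longleftrightarrow> u = v"
  using inj_S by (auto dest: inj_onD)

lemma finite_S: "v \<in> V \<Longrightarrow> finite (S v)"
  using subset_X finite_X finite_subset by blast

lemma comparable: "u \<in> V \<Longrightarrow> v \<in> V \<Longrightarrow> x \<in> S u \<Longrightarrow> x \<in> S v \<Longrightarrow> S u \<subseteq> S v \<or> S v \<subseteq> S u"
  using nested[of u v] by blast

lemma psubset_root: "v \<in> V \<Longrightarrow> v \<noteq> r \<Longrightarrow> S v \<subset> S r"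
  using subset_X root S_eq_iff by blast

definition par :: "'v \<Rightarrow> 'v" where
  "par v = (SOME w. w \<in> V \<and> S v \<subset> S w \<and> (\<forall>u\<in>V. S v \<subset> S u \<longrightarrow> S w \<subseteq> S u))"

lemma par:
  assumes "v \<in> V" "v \<noteq> r"
  shows "par v \<in> V" "S v \<subset> S (par v)" "\<And>u. u \<in> V \<Longrightarrow> S v \<subset> S u \<Longrightarrow> S (par v) \<subseteq> S u"
proof -
  have ex: "\<exists>w. w \<in> V \<and> S v \<subset> S w \<and> (\<forall>u\<in>V. S v \<subset> S u \<longrightarrow> S w \<subseteq> S u)"
  proof -
    obtain x where x: "x \<in> S v" using nonempty[OF assms(1)] by blast
    have "\<exists>w. w \<in> V \<and> S v \<subset> S w" using psubset_root[OF assms] root by blast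
    then obtain w where w: "w \<in> V" "S v \<subset> S w"
      and least: "\<forall>u. u \<in> V \<and> S v \<subset> S u \<longrightarrow> card (S w) \<le> card (S u)"
      using ex_has_least_nat[of "\<lambda>w. w \<in> V \<and> S v \<subset> S w" _ "\<lambda>w. card (S w)"] by blast
    have "S w \<subseteq> S u" if u: "u \<in> V" "S v \<subset> S u" for u
    proof -
      have "S w \<subseteq> S u \<or> S u \<subseteq> S w" using comparable[OF w(1) u(1), of x] x w(2) u(2) by blast
      then show ?thesis
        using card_seteq[OF finite_S[OF w(1)], of "S u"] least u by blast
    qed
    then show ?thesis using w by blast
  qed
  show "par v \<in> V" "S v \<subset> S (par v)" "\<And>u. u \<in> V \<Longrightarrow> S v \<subset> S u \<Longrightarrow> S (par v) \<subseteq> S u"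
    using someI_ex[OF ex] unfolding par_def by blast+
qed

definition T :: "'v rooted_graph" where
  "T = \<lparr>tverts = V, tedges = {{par v, v} | v. v \<in> V - {r}}, troot = r\<rparr>"

lemma T_simps [simp]: "tverts T = V" "troot T = r"
  "tedges T = {{par v, v} | v. v \<in> V - {r}}"
  by (simp_all add: T_def)

lemma par_edge: "v \<in> V \<Longrightarrow> v \<noteq> r \<Longrightarrow> {par v, v} \<in> tedges T"
  by auto

lemma up_induct [consumes 1, case_names root step]:
  assumes "v \<in> V" "P r" "\<And>v. v \<in> V \<Longrightarrow> v \<noteq> r \<Longrightarrow> P (par v) \<Longrightarrow> P v"
  shows "P v"
  using assms(1)
proof (induction "card X - card (S v)" arbitrary: v rule: less_induct)
  case less
  show ?case
  proof (cases "v = r")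
    case False
    note pv = par[OF less.prems False]
    have "card (S v) < card (S (par v))" "card (S (par v)) \<le> card X"
      using psubset_card_mono[OF finite_S[OF pv(1)] pv(2)] card_mono[OF finite_X subset_X[OF pv(1)]]
      by auto
    then show ?thesis using less assms(3) par(1) False by auto
  qed (use assms(2) in simp)
qed

lemma ex_root_path:
  assumes "v \<in> V"
  shows "\<exists>p. is_path T r p v \<and> set p = {w \<in> V. S v \<subseteq> S w}"
  using assms
proof (induction rule: up_induct)
  case root
  have "{w \<in> V. S r \<subseteq> S w} = {r}" using psubset_root hierarchy.root(1)[OF hierarchy_axioms] by blast
  then show ?case using is_path_singleton[of T r] hierarchy.root(1)[OF hierarchy_axioms]
    by (intro exI[of _ "[r]"]) simp
next
  case (step v)
  note v = step.hyps
  obtain p where p: "is_path T r p (par v)" "set p = {w \<in> V. S (par v) \<subseteq> S w}"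
    using step.IH by blast
  have "v \<notin> set p" using p(2) par(2)[OF v] by blast
  then have "is_path T r (p @ [v]) v"
    using is_path_snoc[OF p(1) par_edge[OF v]] v by simp
  moreover have "{w \<in> V. S v \<subseteq> S w} = insert v {w \<in> V. S (par v) \<subseteq> S w}"
  proof -
    have "S v \<subseteq> S w \<longleftrightarrow> w = v \<or> S (par v) \<subseteq> S w" if w: "w \<in> V" for w
      using par(2)[OF v] par(3)[OF v w] S_eq_iff[OF v(1) w] by auto
    then show ?thesis using v(1) by blast
  qed
  ultimately show ?case using p(2) by (intro exI[of _ "p @ [v]"]) simp
qed

text \<open>A vertex of minimal cluster size on a cycle would have two distinct parents.\<close>

lemma acyclic: "\<not> is_cycle T c"
proof
  assume cyc: "is_cycle T c"
  define n where "n = length c"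
  have n: "3 \<le> n" and dist: "distinct c"
    using cyc by (auto simp: is_cycle_def n_def)
  have edge: "{c ! i, c ! (Suc i mod n)} \<in> tedges T" if i: "i < n" for i
  proof (cases "Suc i < n")
    case True
    then have "{c ! i, c ! Suc i} \<in> path_edges c" unfolding path_edges_def n_def by blast
    then show ?thesis using cyc True unfolding is_cycle_def by auto
  next
    case False
    then have "i = n - 1" "Suc i mod n = 0" using i by (auto simp: mod_Suc)
    moreover have "c \<noteq> []" using n by (auto simp: n_def)
    ultimately have "c ! i = last c" "c ! (Suc i mod n) = hd c"
      by (auto simp: n_def last_conv_nth hd_conv_nth )
    then show ?thesis using cyc unfolding is_cycle_def by simp
  qed
  have up: "v = par u" if uv: "{u, v} \<in> tedges T" "card (S u) \<le> card (S v)" for u v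
  proof -
    obtain w where w: "{u, v} = {par w, w}" "w \<in> V" "w \<noteq> r" using uv(1) by auto
    have "card (S w) < card (S (par w))"
      using par(1,2)[OF w(2,3)] finite_S by (auto intro: psubset_card_mono)
    then show ?thesis using w(1) uv(2) by (auto simp: doubleton_eq_iff)
  qed
  obtain i where i: "i < n" and least: "\<forall>j<n. card (S (c ! i)) \<le> card (S (c ! j))"
    using ex_has_least_nat[of "\<lambda>i. i < n" 0 "\<lambda>i. card (S (c ! i))"] n by auto
  define j where "j = (i + n - 1) mod n"
  have j: "j < n" "Suc j mod n = i" using n i
    by (auto simp: j_def mod_Suc_eq)
  have "c ! (Suc i mod n) = par (c ! i)" using up[OF edge[OF i]] least n by simp
  moreover have "c ! j = par (c ! i)"
    using up[of "c ! i" "c ! j"] edge[OF j(1)] j least by (simp add: insert_commute)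
  moreover have "Suc i mod n < n" using n by simp
  ultimately have "Suc i mod n = j"
    using j(1) nth_eq_iff_index_eq[OF dist, of "Suc i mod n" j] by (simp add: n_def)
  then show False using j i n by (auto simp: mod_Suc split: if_splits)
qed

lemma rooted_tree_T: "rooted_tree T"
proof -
  define R where "R = {(a, b). a \<in> tverts T \<and> b \<in> tverts T \<and> {a, b} \<in> tedges T}"
  have "sym R" by (auto simp: R_def sym_def insert_commute)
  have "(v, r) \<in> R\<^sup>*" if "v \<in> V" for v
    using that
  proof (induction rule: up_induct)
    case (step v)
    have "{v, par v} \<in> tedges T" using par_edge[OF step.hyps] by (simp only: insert_commute)
    then have "(v, par v) \<in> R" using step.hyps par(1) by (simp add: R_def)
    then show ?case using step.IH by (rule converse_rtrancl_into_rtrancl)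
  qed simp
  then have "(u, v) \<in> R\<^sup>*" if "u \<in> V" "v \<in> V" for u v
    using that sym_rtrancl[OF \<open>sym R\<close>] by (meson rtrancl_trans symD)
  then have "\<exists>p. is_path T u p v" if "u \<in> V" "v \<in> V" for u v
    using rtrancl_edges_imp_path[of u v T] that unfolding R_def by simp
  moreover have "e \<subseteq> V \<and> card e = 2" if e: "e \<in> tedges T" for e
  proof -
    obtain v where v: "e = {par v, v}" "v \<in> V" "v \<noteq> r" using e by auto
    then have "par v \<noteq> v" using par(2)[OF v(2,3)] by auto
    then show ?thesis using v par(1) by auto
  qed
  ultimately show ?thesis
    unfolding rooted_tree_def using finite_V root(1) acyclic by simp
qed

sublocale tree T
  by unfold_locales (rule rooted_tree_T)

lemma ancestor_iff: "v \<in> V \<Longrightarrow> ancestor T u v \<longleftrightarrow> u \<in> V \<and> S v \<subseteq> S u"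
  using ex_root_path[of v] tree_path_eqI unfolding ancestor_def by fastforce

lemma parent_eq_par:
  assumes "v \<in> V" "v \<noteq> r"
  shows "parent v = par v"
proof (rule ccontr)
  assume "parent v \<noteq> par v"
  then have "par v \<noteq> r" "v = parent (par v)"
    using edge_cases[OF par_edge[OF assms]] by auto
  then have "ancestor T v (par v)"
    using ancestor_parent[of "par v" v] ancestor_refl[of v] par(1)[OF assms] assms by simp
  then show False using ancestor_iff par[OF assms] by blast
qed

lemma inj_parent_edge:
  assumes "{par u, u} = {par v, v}" "u \<in> V" "v \<in> V" "u \<noteq> r" "v \<noteq> r"
  shows "u = v"
  using assms par(2)[of u] par(2)[of v] by (auto simp: doubleton_eq_iff)

lemma ex_child_containing:
  assumes "v \<in> V" "x \<in> S v" "S v \<noteq> {x}"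
  obtains c where "c \<in> V" "c \<noteq> r" "par c = v" "x \<in> S c"
proof -
  have xX: "x \<in> X" using assms subset_X by blast
  have "\<exists>c. c \<in> V \<and> x \<in> S c \<and> S c \<subset> S v"
    using leaf[OF xX] assms by (intro exI[of _ "leaf x"]) auto
  moreover have "\<forall>c. c \<in> V \<and> x \<in> S c \<and> S c \<subset> S v \<longrightarrow> card (S c) \<le> card (S v)"
    using finite_S[OF assms(1)] by (auto intro: card_mono)
  ultimately obtain c where c: "c \<in> V" "x \<in> S c" "S c \<subset> S v"
    and greatest: "\<forall>d. d \<in> V \<and> x \<in> S d \<and> S d \<subset> S v \<longrightarrow> card (S d) \<le> card (S c)"
    using ex_has_greatest_nat[of "\<lambda>c. c \<in> V \<and> x \<in> S c \<and> S c \<subset> S v" _ "\<lambda>c. card (S c)"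
        "Suc (card (S v))"] by (metis less_Suc_eq_le)
  have "c \<noteq> r" using c subset_X[OF assms(1)] root by auto
  note pc = par[OF c(1) this]
  have "S (par c) = S v"
  proof (rule ccontr)
    assume "S (par c) \<noteq> S v"
    then have "S (par c) \<subset> S v" using pc(3)[OF assms(1) c(3)] by blast
    then have "card (S (par c)) \<le> card (S c)" using greatest pc c(2) by blast
    then show False using psubset_card_mono[OF finite_S[OF pc(1)] pc(2)] by simp
  qed
  then have "par c = v" using S_eq_iff pc(1) assms(1) by blast
  then show ?thesis using that c \<open>c \<noteq> r\<close> by blast
qed

lemma finite_tedges: "finite (tedges T)"
proof -
  have "tedges T \<subseteq> Pow V" using par(1) by auto
  then show ?thesis using finite_V finite_subset by blast
qed

lemma degree_inner:
  assumes "v \<in> V" "\<nexists>x. S v = {x}"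
  shows "2 \<le> degree T v" "v \<noteq> r \<Longrightarrow> 3 \<le> degree T v"
proof -
  obtain x where x: "x \<in> S v" using nonempty[OF assms(1)] by blast
  obtain c where c: "c \<in> V" "c \<noteq> r" "par c = v" "x \<in> S c"
    using ex_child_containing[OF assms(1) x] assms(2) by blast
  obtain y where y: "y \<in> S v" "y \<notin> S c" using par(2)[OF c(1,2)] c(3) by blast
  obtain d where d: "d \<in> V" "d \<noteq> r" "par d = v" "y \<in> S d"
    using ex_child_containing[OF assms(1) y(1)] assms(2) by blast
  have cd: "c \<noteq> d" using d y by blast
  have cv: "c \<noteq> v" "d \<noteq> v" using par(2)[OF c(1,2)] par(2)[OF d(1,2)] c d by auto
  have fin: "finite {e \<in> tedges T. v \<in> e}" using finite_tedges by simp
  have ce: "{v, c} \<in> {e \<in> tedges T. v \<in> e}" and de: "{v, d} \<in> {e \<in> tedges T. v \<in> e}"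
    using par_edge[OF c(1,2)] par_edge[OF d(1,2)] c(3) d(3) by (simp_all del: T_simps)
  have "card {{v, c}, {v, d}} = 2" using cd by (auto simp: doubleton_eq_iff)
  then show "2 \<le> degree T v"
    unfolding degree_def using card_mono[OF fin, of "{{v, c}, {v, d}}"] ce de by simp
  assume vr: "v \<noteq> r"
  have pe: "{par v, v} \<in> {e \<in> tedges T. v \<in> e}" using par_edge[OF assms(1) vr] by simp
  have "c \<noteq> par v" "d \<noteq> par v"
    using par(2)[OF c(1,2)] par(2)[OF d(1,2)] c d par(2)[OF assms(1) vr] by auto
  then have "card {{par v, v}, {v, c}, {v, d}} = 3" using cd cv by (auto simp: doubleton_eq_iff)
  then show "3 \<le> degree T v"
    unfolding degree_def
    using card_mono[OF fin, of "{{par v, v}, {v, c}, {v, d}}"] ce de pe by simp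
qed

lemma leaf_neq_root: "x \<in> X \<Longrightarrow> leaf x \<noteq> r"
  using leaf(2)[of x] root(2) card_X by auto

lemma degree_leaf:
  assumes "x \<in> X"
  shows "degree T (leaf x) = 1"
proof -
  have "par v \<noteq> leaf x" if "v \<in> V" "v \<noteq> r" for v
  proof
    assume "par v = leaf x"
    then have "S v \<subset> {x}" using par(2)[OF that] leaf(2)[OF assms] by simp
    then show False using nonempty[OF that(1)] by blast
  qed
  then have "{e \<in> tedges T. leaf x \<in> e} = {{par (leaf x), leaf x}}"
    using par_edge[OF leaf(1) leaf_neq_root, OF assms assms] by fastforce
  then show ?thesis by (simp add: degree_def)
qed

lemma singleton_cluster: "v \<in> V \<Longrightarrow> S v = {x} \<Longrightarrow> x \<in> X \<and> v = leaf x"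
  using leaf[of x] subset_X[of v] S_eq_iff[of v "leaf x"] by auto

lemma phylogenetic_T: "phylogenetic_tree_on (leaf ` X) T"
proof -
  have "\<nexists>x. S r = {x}" using root(2) card_X by auto
  then have deg_r: "2 \<le> degree T r" using degree_inner(1)[OF root(1)] by blast
  have inner: "3 \<le> degree T v" if "v \<in> V" "v \<noteq> r" "v \<notin> leaf ` X" for v
    using degree_inner(2)[of v] singleton_cluster[of v] that by blast
  have lv: "leaves T = leaf ` X"
  proof (intro equalityI subsetI)
    fix v assume "v \<in> leaves T"
    then show "v \<in> leaf ` X" using inner[of v] by (fastforce simp: leaves_def)
  next
    fix v assume "v \<in> leaf ` X"
    then show "v \<in> leaves T" using leaf(1) leaf_neq_root degree_leaf by (auto simp: leaves_def)
  qed
  then show ?thesis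
    unfolding phylogenetic_tree_on_def using rooted_tree_T deg_r inner by (auto simp del: T_simps(3))
qed

end

section \<open>Characterisation of restricted Fitch maps\<close>

lemma nbh_subset: "y \<in> X \<Longrightarrow> nbh X \<epsilon> m y \<subseteq> X"
  by (auto simp: nbh_def)

lemma self_in_nbh: "y \<in> nbh X \<epsilon> m y"
  by (simp add: nbh_def)

lemma hierarchy_like_add_trivial:
  assumes "hierarchy_like A" "\<And>N. N \<in> A \<Longrightarrow> N \<subseteq> X"
  shows "hierarchy_like (A \<union> {X} \<union> (\<lambda>x. {x}) ` X)"
proof -
  have "P \<inter> Q = P \<or> P \<inter> Q = Q \<or> P \<inter> Q = {}"
    if PQ: "P \<in> A \<union> {X} \<union> (\<lambda>x. {x}) ` X" "Q \<in> A \<union> {X} \<union> (\<lambda>x. {x}) ` X" for P Q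
  proof -
    have sub: "P \<subseteq> X" "Q \<subseteq> X" using PQ assms(2) by auto
    consider "P \<in> A" "Q \<in> A" | "P = X \<or> Q = X" | x where "P = {x} \<or> Q = {x}"
      using PQ by blast
    then show ?thesis
    proof cases
      case 1
      then show ?thesis using assms(1) by (auto simp: hierarchy_like_def)
    qed (use sub in auto)
  qed
  then show ?thesis by (auto simp: hierarchy_like_def)
qed

lemma restricted_Fitch_mapI:
  assumes finX: "finite X" and X2: "2 \<le> card X"
    and hier: "hierarchy_like (nbhs X M \<epsilon>)"
    and mono: "\<forall>m\<in>M. \<forall>y\<in>X. \<forall>y'\<in>nbh X \<epsilon> m y. card (nbh X \<epsilon> m y') \<le> card (nbh X \<epsilon> m y)"
    and k: "\<forall>N\<in>nbhs X M \<epsilon>. N \<noteq> X \<longrightarrow> card {m \<in> M. \<exists>y\<in>X. N = nbh X \<epsilon> m y} \<le> k"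
  shows "restricted_Fitch_map k X M \<epsilon>"
proof -
  define H where "H = nbhs X M \<epsilon> \<union> {X} \<union> (\<lambda>x. {x}) ` X"
  have nbhs_sub: "N \<subseteq> X \<and> N \<noteq> {}" if N: "N \<in> nbhs X M \<epsilon>" for N
    using N nbh_subset self_in_nbh unfolding nbhs_def by fastforce
  have HX: "A \<subseteq> X \<and> A \<noteq> {}" if "A \<in> H" for A
    using that nbhs_sub X2 unfolding H_def by auto
  have "H \<subseteq> Pow X" using HX by blast
  then have finH: "finite H" using finX finite_subset by blast
  have hierH: "hierarchy_like H"
    unfolding H_def using hierarchy_like_add_trivial[OF hier] nbhs_sub by blast
  obtain g :: "'a set \<Rightarrow> nat" where g: "inj_on g H"
    using finite_imp_inj_to_nat_seg[OF finH] by blast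
  define vert :: "'a set \<Rightarrow> 'a + nat" where
    "vert A = (if \<exists>x. A = {x} then Inl (the_elem A) else Inr (g A))" for A
  have vert_single: "vert {x} = Inl x" for x by (simp add: vert_def)
  have inj: "inj_on vert H"
    using g by (auto simp: inj_on_def vert_def split: if_splits)
  define S where "S = inv_into H vert"
  have S_vert: "S (vert A) = A" if "A \<in> H" for A
    unfolding S_def using inj that by (rule inv_into_f_f)
  have S_in: "S v \<in> H" if "v \<in> vert ` H" for v using that S_vert by auto
  have XH: "X \<in> H" and single: "\<And>x. x \<in> X \<Longrightarrow> {x} \<in> H" by (auto simp: H_def)
  interpret hierarchy "vert ` H" S "vert X" X Inl
  proof
    show "finite (vert ` H)" using finH by simp
    show "inj_on S (vert ` H)" unfolding S_def by (rule inj_on_inv_into) simp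
    show "S u \<inter> S v \<in> {S u, S v, {}}" if "u \<in> vert ` H" "v \<in> vert ` H" for u v
      using hierH S_in[OF that(1)] S_in[OF that(2)] unfolding hierarchy_like_def by blast
    show "S v \<noteq> {}" "S v \<subseteq> X" if "v \<in> vert ` H" for v
      using HX S_in[OF that] by auto
    show "vert X \<in> vert ` H" "S (vert X) = X" using XH S_vert by auto
    show "Inl x \<in> vert ` H" if "x \<in> X" for x
      using single[OF that] vert_single by (metis imageI)
    show "S (Inl x) = {x}" if "x \<in> X" for x
      using S_vert[OF single[OF that]] vert_single by simp
  qed (fact finX X2)+
  let ?V = "vert ` H" and ?r = "vert X"
  define lab where "lab e =
    {m \<in> M. \<exists>y\<in>X. \<exists>z\<in>?V. z \<noteq> ?r \<and> e = {par z, z} \<and> S z = nbh X \<epsilon> m y}" for e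
  have lab: "lab {par z, z} = {m \<in> M. \<exists>y\<in>X. S z = nbh X \<epsilon> m y}" if z: "z \<in> ?V" "z \<noteq> ?r" for z
  proof -
    have "w = z" if "w \<in> ?V" "w \<noteq> ?r" "{par z, z} = {par w, w}" for w
      using inj_parent_edge[OF that(3) z(1) that(1) z(2) that(2)] by simp
    then have "(\<exists>w\<in>?V. w \<noteq> ?r \<and> {par z, z} = {par w, w} \<and> S w = N) \<longleftrightarrow> S z = N" for N
      using z by metis
    then show ?thesis unfolding lab_def by simp
  qed
  have "edge_labeled_tree X M T lab"
    unfolding edge_labeled_tree_def using phylogenetic_T by (auto simp: lab_def)
  moreover have "card (lab e) \<le> k" if e: "e \<in> tedges T" for e
  proof -
    obtain z where z: "z \<in> ?V" "z \<noteq> ?r" "e = {par z, z}" using e by auto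
    then have "S z \<noteq> X" using S_eq_iff root by metis
    show ?thesis
    proof (cases "S z \<in> nbhs X M \<epsilon>")
      case True
      then show ?thesis using k \<open>S z \<noteq> X\<close> lab[OF z(1,2)] z(3) by simp
    next
      case False
      then have "lab e = {}" using lab[OF z(1,2)] z(3) by (auto simp: nbhs_def)
      then show ?thesis by simp
    qed
  qed
  moreover have "explains X M T lab \<epsilon>"
  proof -
    have "m \<in> \<epsilon> (x, y) \<longleftrightarrow>
        (\<exists>e \<in> path_edges (tree_path T (lca T (Inl x) (Inl y)) (Inl y)). m \<in> lab e)"
      if x: "x \<in> X" and y: "y \<in> X" and xy: "x \<noteq> y" and m: "m \<in> M" for x y m
    proof -
      have anc: "ancestor T z (Inl x) \<longleftrightarrow> z \<in> ?V \<and> x \<in> S z" if x: "x \<in> X" for z x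
        using ancestor_iff[OF leaf(1)[OF x]] leaf(2)[OF x] by simp
      have not_root: "z \<noteq> ?r" if "x \<notin> S z" for z
        using that x root(2) by metis
      have edges: "path_edges (tree_path T (lca T (Inl x) (Inl y)) (Inl y)) =
          {{par z, z} | z. z \<in> ?V \<and> y \<in> S z \<and> x \<notin> S z}"
      proof -
        have verts: "Inl x \<in> tverts T" "Inl y \<in> tverts T"
          using leaf(1)[OF x] leaf(1)[OF y] by simp_all
        have "parent z = par z" if "z \<in> ?V" "x \<notin> S z" for z
          using parent_eq_par[OF that(1)] not_root[OF that(2)] by simp
        then have "e = {parent z, z} \<and> (z \<in> ?V \<and> y \<in> S z) \<and> \<not> (z \<in> ?V \<and> x \<in> S z) \<longleftrightarrow>
            e = {par z, z} \<and> z \<in> ?V \<and> y \<in> S z \<and> x \<notin> S z" for e z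
          by (cases "z \<in> ?V"; cases "x \<in> S z") simp_all
        then show ?thesis
          unfolding path_edges_lca[OF verts] anc[OF x] anc[OF y] by presburger
      qed
      have "(\<exists>e \<in> path_edges (tree_path T (lca T (Inl x) (Inl y)) (Inl y)). m \<in> lab e) \<longleftrightarrow>
          (\<exists>z\<in>?V. y \<in> S z \<and> x \<notin> S z \<and> m \<in> lab {par z, z})"
        unfolding edges by blast
      also have "\<dots> \<longleftrightarrow> (\<exists>z\<in>?V. y \<in> S z \<and> x \<notin> S z \<and> (\<exists>y'\<in>X. S z = nbh X \<epsilon> m y'))"
        using lab not_root m by (intro bex_cong conj_cong refl) simp
      also have "\<dots> \<longleftrightarrow> x \<notin> nbh X \<epsilon> m y"
      proof
        assume "x \<notin> nbh X \<epsilon> m y"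
        moreover have N: "nbh X \<epsilon> m y \<in> H" using m y by (auto simp: H_def nbhs_def)
        ultimately show "\<exists>z\<in>?V. y \<in> S z \<and> x \<notin> S z \<and> (\<exists>y'\<in>X. S z = nbh X \<epsilon> m y')"
          using S_vert[OF N] self_in_nbh y by (intro bexI[of _ "vert (nbh X \<epsilon> m y)"]) auto
      next
        assume "\<exists>z\<in>?V. y \<in> S z \<and> x \<notin> S z \<and> (\<exists>y'\<in>X. S z = nbh X \<epsilon> m y')"
        then obtain y' where y': "y' \<in> X" "y \<in> nbh X \<epsilon> m y'" "x \<notin> nbh X \<epsilon> m y'" by auto
        have "nbh X \<epsilon> m y \<inter> nbh X \<epsilon> m y' \<in> {nbh X \<epsilon> m y, nbh X \<epsilon> m y', {}}"
          using hier m y y'(1) unfolding hierarchy_like_def nbhs_def by blast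
        then have "nbh X \<epsilon> m y \<subseteq> nbh X \<epsilon> m y' \<or> nbh X \<epsilon> m y' \<subseteq> nbh X \<epsilon> m y"
          using y'(2) self_in_nbh[of y X \<epsilon> m] by auto
        moreover have "card (nbh X \<epsilon> m y) \<le> card (nbh X \<epsilon> m y')" using mono m y' by blast
        moreover have "finite (nbh X \<epsilon> m y)"
          using nbh_subset[OF y] finX by (rule finite_subset)
        ultimately have "nbh X \<epsilon> m y \<subseteq> nbh X \<epsilon> m y'" using card_seteq by blast
        then show "x \<notin> nbh X \<epsilon> m y" using y'(3) by blast
      qed
      also have "\<dots> \<longleftrightarrow> m \<in> \<epsilon> (x, y)" using x xy by (simp add: nbh_def)
      finally show ?thesis by simp
    qed
    then show ?thesis by (auto simp: explains_def irr_def simp del: T_simps)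
  qed
  ultimately show ?thesis unfolding restricted_Fitch_map_def by blast
qed

lemma restricted_Fitch_map_singleton: "restricted_Fitch_map k {a} M \<epsilon>"
proof -
  define T :: "('a + nat) rooted_graph" where
    "T = \<lparr>tverts = {Inl a}, tedges = {}, troot = Inl a\<rparr>"
  have "is_path T (Inl a) [Inl a] (Inl a)" by (simp add: T_def is_path_def)
  moreover have "\<not> is_cycle T c" for c by (simp add: T_def is_cycle_def)
  ultimately have "rooted_tree T" by (auto simp: rooted_tree_def T_def)
  then have "edge_labeled_tree {a} M T (\<lambda>_. {})"
    by (simp add: edge_labeled_tree_def phylogenetic_tree_on_def T_def)
  moreover have "explains {a} M T (\<lambda>_. {}) \<epsilon>" by (simp add: explains_def irr_def)
  ultimately show ?thesis unfolding restricted_Fitch_map_def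
    by (intro exI[of _ T] exI[of _ "\<lambda>_. {}"]) (simp add: T_def)
qed

theorem theorem4:
  fixes X :: "'a set" and M :: "'m set" and \<epsilon> :: "'a \<times> 'a \<Rightarrow> 'm set" and k :: nat
  assumes "finite X" and "X \<noteq> {}" and "finite M" and "M \<noteq> {}"
    and "\<epsilon> \<in> irr X \<rightarrow> Pow M"
  shows "restricted_Fitch_map k X M \<epsilon> \<longleftrightarrow>
    hierarchy_like (nbhs X M \<epsilon>) \<and>
    (\<forall>m\<in>M. \<forall>y\<in>X. \<forall>y'\<in>nbh X \<epsilon> m y. card (nbh X \<epsilon> m y') \<le> card (nbh X \<epsilon> m y)) \<and>
    (\<forall>N\<in>nbhs X M \<epsilon>. N \<noteq> X \<longrightarrow> card {m \<in> M. \<exists>y\<in>X. N = nbh X \<epsilon> m y} \<le> k)"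
proof
  assume fitch: "restricted_Fitch_map k X M \<epsilon>"
  have "card (nbh X \<epsilon> m y') \<le> card (nbh X \<epsilon> m y)"
    if "m \<in> M" "y \<in> X" "y' \<in> nbh X \<epsilon> m y" for m y y'
    using restricted_Fitch_map_imp(2)[OF assms(3) fitch] that
      finite_subset[OF nbh_subset[OF that(2)] assms(1)] by (intro card_mono) auto
  then show "hierarchy_like (nbhs X M \<epsilon>) \<and>
    (\<forall>m\<in>M. \<forall>y\<in>X. \<forall>y'\<in>nbh X \<epsilon> m y. card (nbh X \<epsilon> m y') \<le> card (nbh X \<epsilon> m y)) \<and>
    (\<forall>N\<in>nbhs X M \<epsilon>. N \<noteq> X \<longrightarrow> card {m \<in> M. \<exists>y\<in>X. N = nbh X \<epsilon> m y} \<le> k)"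
    using restricted_Fitch_map_imp(1,3)[OF assms(3) fitch] by blast
next
  assume *: "hierarchy_like (nbhs X M \<epsilon>) \<and>
    (\<forall>m\<in>M. \<forall>y\<in>X. \<forall>y'\<in>nbh X \<epsilon> m y. card (nbh X \<epsilon> m y') \<le> card (nbh X \<epsilon> m y)) \<and>
    (\<forall>N\<in>nbhs X M \<epsilon>. N \<noteq> X \<longrightarrow> card {m \<in> M. \<exists>y\<in>X. N = nbh X \<epsilon> m y} \<le> k)"
  show "restricted_Fitch_map k X M \<epsilon>"
  proof (cases "card X = 1")
    case True
    then show ?thesis using restricted_Fitch_map_singleton by (metis card_1_singletonE)
  next
    case False
    moreover have "card X \<noteq> 0" using assms by simp
    ultimately have "2 \<le> card X" by linarith
    then show ?thesis using restricted_Fitch_mapI[OF assms(1)] * by blast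
  qed
qed

end
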